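(* Let $n \geq 2$, let $Y_1, \dots, Y_n$ be independent random variables with common distribution $N(\mu, \sigma^2)$, $\sigma^2>0$, let $\overline{Y} = \frac{1}{n}\sum_{i=1}^n Y_i$, and $R_j = Y_j - \overline{Y}$ for $j=1,\dots,n$. For $c\in\mathbb{R}$ let $W_j = R_{j+1} + cR_1$, $j = 1, \dots, n-1$. Imposing the conditions that the $W_j$ be i.i.d. with $W_j \sim N(0,\sigma^2)$, and that $\sum_{j=1}^{n-1} W_j^2 = \sum_{j=1}^{n} R_j^2$, there are exactly two solutions for $c$: $$c = \frac{1}{\sqrt{n}-1} \quad\text{or}\quad c = \frac{-1}{\sqrt{n}+1}.$$
   Context: $N(\mu,\sigma^2)$ is the normal distribution with mean $\mu\in\mathbb{R}$ and variance $\sigma^2$. *)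

theory Defs
  imports "HOL-Probability.Probability"
begin

definition sample_mean :: "nat \<Rightarrow> (nat \<Rightarrow> 'a \<Rightarrow> real) \<Rightarrow> 'a \<Rightarrow> real" where
  "sample_mean n Y \<omega> = (\<Sum>i = 1..n. Y i \<omega>) / real n"

definition residual :: "nat \<Rightarrow> (nat \<Rightarrow> 'a \<Rightarrow> real) \<Rightarrow> nat \<Rightarrow> 'a \<Rightarrow> real" where
  "residual n Y j \<omega> = Y j \<omega> - sample_mean n Y \<omega>"

definition shifted_residual ::
  "nat \<Rightarrow> (nat \<Rightarrow> 'a \<Rightarrow> real) \<Rightarrow> real \<Rightarrow> nat \<Rightarrow> 'a \<Rightarrow> real" where
  "shifted_residual n Y c j \<omega> = residual n Y (j + 1) \<omega> + c * residual n Y 1 \<omega>"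

(* The second parameter of normal_density is the standard deviation, not the variance;
   this is N(\<mu>, \<sigma>\<^sup>2) when \<sigma> > 0. *)
definition iid_normal ::
  "'a measure \<Rightarrow> (nat \<Rightarrow> 'a \<Rightarrow> real) \<Rightarrow> nat set \<Rightarrow> real \<Rightarrow> real \<Rightarrow> bool" where
  "iid_normal M X I \<mu> \<sigma> \<longleftrightarrow>
     prob_space.indep_vars M (\<lambda>_. borel) X I \<and>
     (\<forall>i\<in>I. distributed M lborel (X i) (normal_density \<mu> \<sigma>))"

end

theory Submission
  imports Defs
begin

text \<open>
  Since the residuals sum to \<open>0\<close>, the two sums of squares differ by
  \<open>((n - 1) c\<^sup>2 - 2 c - 1) R\<^sub>1\<^sup>2\<close>, and \<open>R\<^sub>1\<close> is a nondegenerate normal variable, so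
  \<open>c\<close> has to be one of the two roots of that quadratic. For such a root, the \<open>W\<^sub>j\<close> are all
  but the first of the coordinates of a Householder reflection \<open>x \<mapsto> x - \<langle>b, x\<rangle> b\<close>,
  \<open>\<parallel>b\<parallel>\<^sup>2 = 2\<close>, applied to the centred sample, and a reflection preserves the distribution
  of an i.i.d. centred normal sample: it preserves both the Lebesgue measure and the joint
  density, which depends only on \<open>\<parallel>x\<parallel>\<close>.
\<close>

section \<open>Densities and Lebesgue measure on finite products\<close>

text \<open>It suffices to compare the two measures on boxes. There the indicator splits into one
  factor per coordinate, and the integral of a product of one-variable functions is the product of
  the integrals.\<close>

lemma PiM_density:
  assumes "finite I" "\<And>i. sigma_finite_measure (N i)"
    and [measurable]: "\<And>i. f i \<in> borel_measurable (N i)"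
    and "\<And>i. sigma_finite_measure (density (N i) (f i))"
  shows "PiM I (\<lambda>i. density (N i) (f i)) = density (PiM I N) (\<lambda>x. \<Prod>i\<in>I. f i (x i))"
proof -
  interpret N: product_sigma_finite N by (simp add: product_sigma_finite_def assms)
  interpret D: product_sigma_finite "\<lambda>i. density (N i) (f i)"
    by (simp add: product_sigma_finite_def assms)
  have sets_eq: "sets (PiM I (\<lambda>i. density (N i) (f i))) = sets (PiM I N)"
    by (intro sets_PiM_cong) auto
  show ?thesis
  proof (rule D.PiM_eqI[symmetric])
    fix A assume A: "\<And>i. i \<in> I \<Longrightarrow> A i \<in> sets (density (N i) (f i))"
    then have A': "\<And>i. i \<in> I \<Longrightarrow> A i \<in> sets (N i)" by simp
    have box: "Pi\<^sub>E I A \<in> sets (PiM I N)"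
      using A' \<open>finite I\<close> by (intro sets_PiM_I_finite) auto
    have ind: "(\<Prod>i\<in>I. f i (x i)) * indicator (Pi\<^sub>E I A) x
        = (\<Prod>i\<in>I. f i (x i) * indicator (A i) (x i))" if "x \<in> space (PiM I N)" for x
    proof (cases "x \<in> Pi\<^sub>E I A")
      case True
      then show ?thesis by (auto simp: PiE_iff intro!: prod.cong)
    next
      case False
      \<comment> \<open>Extensionality rules out leaving the box through an index outside
        \<open>I\<close>, so some factor on the right vanishes.\<close>
      moreover have "x \<in> extensional I"
        using that by (simp add: space_PiM PiE_iff)
      ultimately obtain i where "i \<in> I" "x i \<notin> A i"
        by (auto simp: PiE_iff)
      then show ?thesis
        using False \<open>finite I\<close>
        by (subst prod_zero) (auto intro!: bexI[of _ i] simp: indicator_def)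
    qed
    have "emeasure (density (PiM I N) (\<lambda>x. \<Prod>i\<in>I. f i (x i))) (Pi\<^sub>E I A)
        = (\<integral>\<^sup>+x. (\<Prod>i\<in>I. f i (x i)) * indicator (Pi\<^sub>E I A) x \<partial>PiM I N)"
      using box by (intro emeasure_density) auto
    also have "\<dots> = (\<integral>\<^sup>+x. (\<Prod>i\<in>I. f i (x i) * indicator (A i) (x i)) \<partial>PiM I N)"
      by (intro nn_integral_cong ind)
    also have "\<dots> = (\<Prod>i\<in>I. \<integral>\<^sup>+x. f i x * indicator (A i) x \<partial>N i)"
      using A' \<open>finite I\<close> by (intro N.product_nn_integral_prod) auto
    also have "\<dots> = (\<Prod>i\<in>I. emeasure (density (N i) (f i)) (A i))"
      using A' by (intro prod.cong refl emeasure_density[symmetric]) auto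
    finally show "emeasure (density (PiM I N) (\<lambda>x. \<Prod>i\<in>I. f i (x i))) (Pi\<^sub>E I A)
        = (\<Prod>i\<in>I. emeasure (density (N i) (f i)) (A i))" .
  qed (use sets_eq \<open>finite I\<close> in auto)
qed

text \<open>The preimage of a box is the box of the translated sides, which reduces the claim to
  translation invariance on the line.\<close>

lemma distr_PiM_lborel_translation:
  fixes t :: "'i \<Rightarrow> real"
  assumes "finite I"
  shows "distr (PiM I (\<lambda>_. lborel)) (PiM I (\<lambda>_. lborel)) (\<lambda>x. \<lambda>i\<in>I. x i + t i) = PiM I (\<lambda>_. lborel)"
proof -
  interpret product_sigma_finite "\<lambda>_::'i. lborel :: real measure"
    by (simp add: product_sigma_finite_def sigma_finite_lborel)
  show ?thesis
  proof (rule PiM_eqI)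
    fix A :: "'i \<Rightarrow> real set" assume A: "\<And>i. i \<in> I \<Longrightarrow> A i \<in> sets lborel"
    have A_shift: "(\<lambda>x. x + t i) -` A i \<in> sets lborel" if "i \<in> I" for i
      using measurable_sets[of "\<lambda>x. x + t i" borel borel "A i"] A[OF that] by simp
    have "(\<lambda>x. \<lambda>i\<in>I. x i + t i) -` Pi\<^sub>E I A \<inter> space (PiM I (\<lambda>_. lborel))
        = Pi\<^sub>E I (\<lambda>i. (\<lambda>x. x + t i) -` A i)"
      by (auto simp: space_PiM PiE_iff)
    then have "emeasure (distr (PiM I (\<lambda>_. lborel)) (PiM I (\<lambda>_. lborel)) (\<lambda>x. \<lambda>i\<in>I. x i + t i)) (Pi\<^sub>E I A)
        = emeasure (PiM I (\<lambda>_. lborel)) (Pi\<^sub>E I (\<lambda>i. (\<lambda>x. x + t i) -` A i))"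
      using A \<open>finite I\<close> by (subst emeasure_distr) (auto intro!: sets_PiM_I_finite)
    also have "\<dots> = (\<Prod>i\<in>I. emeasure lborel ((\<lambda>x. x + t i) -` A i))"
      using A_shift \<open>finite I\<close> by (intro emeasure_PiM) auto
    also have "\<dots> = (\<Prod>i\<in>I. emeasure lborel (A i))"
    proof (rule prod.cong[OF refl])
      fix i assume "i \<in> I"
      have "emeasure lborel (A i) = emeasure (distr lborel borel ((+) (t i))) (A i)"
        using lborel_distr_plus[of "t i"] by simp
      also have "\<dots> = emeasure lborel ((\<lambda>x. x + t i) -` A i)"
        using A[OF \<open>i \<in> I\<close>] by (subst emeasure_distr) (auto simp: vimage_def add.commute)
      finally show "emeasure lborel ((\<lambda>x. x + t i) -` A i) = emeasure lborel (A i)" by simp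
    qed
    finally show "emeasure (distr (PiM I (\<lambda>_. lborel)) (PiM I (\<lambda>_. lborel)) (\<lambda>x. \<lambda>i\<in>I. x i + t i)) (Pi\<^sub>E I A)
        = (\<Prod>i\<in>I. emeasure lborel (A i))" .
  qed (use \<open>finite I\<close> in auto)
qed

text \<open>The integral form allows \<open>F\<close> to be a density times an indicator, which is
  how the invariance of the normal law is derived.\<close>

lemma nn_integral_PiM_lborel_reflection:
  fixes b :: "'i \<Rightarrow> real"
  assumes "finite I" and b2: "(\<Sum>i\<in>I. (b i)\<^sup>2) = 2"
    and F: "F \<in> borel_measurable (PiM I (\<lambda>_. lborel))"
  shows "(\<integral>\<^sup>+x. F (\<lambda>i\<in>I. x i - b i * (\<Sum>j\<in>I. b j * x j)) \<partial>PiM I (\<lambda>_. lborel))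
       = (\<integral>\<^sup>+x. F x \<partial>PiM I (\<lambda>_. lborel))"
proof -
  interpret product_sigma_finite "\<lambda>_::'i. lborel :: real measure"
    by (simp add: product_sigma_finite_def sigma_finite_lborel)
  \<comment> \<open>\<open>k\<close> is the coordinate to be traded for the scalar product with
    \<open>b\<close>; solving for \<open>x k\<close> divides by \<open>b k\<close>.\<close>
  obtain k where k: "k \<in> I" "b k \<noteq> 0"
    using b2 by (metis (no_types, lifting) power_zero_numeral sum.neutral zero_neq_numeral)
  define J where "J = I - {k}"
  have J: "finite J" "k \<notin> J" and I: "I = insert k J"
    using \<open>finite I\<close> k by (auto simp: J_def)
  interpret J: finite_product_sigma_finite "\<lambda>_::'i. lborel :: real measure" J
    by standard (fact J)
  interpret P: pair_sigma_finite "PiM J (\<lambda>_. lborel :: real measure)" "lborel :: real measure" ..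
  define B where "B x = (\<Sum>j\<in>J. b j * x j)" for x :: "'i \<Rightarrow> real"
  note F[unfolded I, measurable]
  have [measurable]: "B \<in> borel_measurable (PiM J (\<lambda>_. lborel))"
    unfolding B_def by measurable
  have bJ: "(\<Sum>j\<in>J. (b j)\<^sup>2) = 2 - (b k)\<^sup>2"
    using b2 J unfolding I by simp
  have B_shift: "B (\<lambda>i\<in>J. x i + s * b i) = B x + s * (2 - (b k)\<^sup>2)" for x s
    unfolding B_def bJ[symmetric] sum_distrib_left sum.distrib[symmetric]
    by (intro sum.cong) (auto simp: power2_eq_square algebra_simps)
  \<comment> \<open>In the coordinate \<open>s = \<Sum>i. b i * x i\<close>, used in place of \<open>x k\<close>, the reflection
    translates the remaining coordinates and then maps \<open>s\<close> to \<open>- s\<close>; each of these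
    steps is handled by Fubini.\<close>
  define G where "G x s = F ((\<lambda>i\<in>J. x i - s * b i)(k := (s - B x) / b k - s * b k))" for x s
  have G_meas [measurable]: "(\<lambda>(x, s). G x s) \<in> borel_measurable (PiM J (\<lambda>_. lborel) \<Otimes>\<^sub>M lborel)"
    unfolding G_def by measurable
  have cancel: "ennreal \<bar>b k\<bar> * (a / ennreal \<bar>b k\<bar>) = a" for a
    using k by (simp add: ennreal_times_divide mult_divide_eq_ennreal mult.commute)
  have sum_upd: "(\<Sum>j\<in>I. b j * (x(k := y)) j) = b k * y + B x" for x y
    using J unfolding I B_def by (simp, intro sum.cong) auto
  have "(\<integral>\<^sup>+x. F (\<lambda>i\<in>I. x i - b i * (\<Sum>j\<in>I. b j * x j)) \<partial>PiM I (\<lambda>_. lborel))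
      = (\<integral>\<^sup>+x. \<integral>\<^sup>+y. G x (B x + b k * y) \<partial>lborel \<partial>PiM J (\<lambda>_. lborel))"
    unfolding I
  proof (subst product_nn_integral_insert)
    show "(\<lambda>x. F (\<lambda>i\<in>insert k J. x i - b i * (\<Sum>j\<in>insert k J. b j * x j)))
        \<in> borel_measurable (PiM (insert k J) (\<lambda>_. lborel))"
      by measurable
    have "(\<lambda>i\<in>insert k J. (x(k := y)) i - b i * (\<Sum>j\<in>insert k J. b j * (x(k := y)) j))
        = (\<lambda>i\<in>J. x i - (B x + b k * y) * b i)(k := (B x + b k * y - B x) / b k - (B x + b k * y) * b k)"
      for x y
      using J k unfolding sum_upd[unfolded I] by (auto simp: fun_eq_iff algebra_simps)
    then show "(\<integral>\<^sup>+x. \<integral>\<^sup>+y. F (\<lambda>i\<in>insert k J. (x(k := y)) i - b i * (\<Sum>j\<in>insert k J. b j * (x(k := y)) j)) \<partial>lborel \<partial>PiM J (\<lambda>_. lborel))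
        = (\<integral>\<^sup>+x. \<integral>\<^sup>+y. G x (B x + b k * y) \<partial>lborel \<partial>PiM J (\<lambda>_. lborel))"
      by (simp only: G_def)
  qed (use J in auto)
  \<comment> \<open>For fixed \<open>x\<close>, substitute \<open>s = B x + b k * y\<close>, with
    Jacobian factor \<open>\<bar>b k\<bar>\<close>.\<close>
  also have "\<dots> = (\<integral>\<^sup>+x. \<integral>\<^sup>+s. G x s / ennreal \<bar>b k\<bar> \<partial>lborel \<partial>PiM J (\<lambda>_. lborel))"
  proof (rule nn_integral_cong)
    fix x :: "'i \<Rightarrow> real" assume [measurable]: "x \<in> space (PiM J (\<lambda>_. lborel))"
    have [measurable]: "G x \<in> borel_measurable borel"
      using measurable_Pair2[OF G_meas, of x] by simp
    show "(\<integral>\<^sup>+y. G x (B x + b k * y) \<partial>lborel) = (\<integral>\<^sup>+s. G x s / ennreal \<bar>b k\<bar> \<partial>lborel)"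
      using k by (subst nn_integral_real_affine[where c = "b k" and t = "B x"])
        (simp_all add: nn_integral_cmult[symmetric] cancel)
  qed
  \<comment> \<open>With \<open>s\<close> as the outer variable, the shift by \<open>s * b i\<close>
    of the coordinates in \<open>J\<close> is a translation by a constant vector.\<close>
  also have "\<dots> = (\<integral>\<^sup>+s. \<integral>\<^sup>+x. G x s / ennreal \<bar>b k\<bar> \<partial>PiM J (\<lambda>_. lborel) \<partial>lborel)"
    by (rule P.Fubini'[symmetric]) simp
  also have "\<dots> = (\<integral>\<^sup>+s. \<integral>\<^sup>+x. F (x(k := (- B x - s) / b k)) / ennreal \<bar>b k\<bar> \<partial>PiM J (\<lambda>_. lborel) \<partial>lborel)"
  proof (rule nn_integral_cong)
    fix s :: real
    have [measurable]: "(\<lambda>x. G x s) \<in> borel_measurable (PiM J (\<lambda>_. lborel))"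
      using measurable_Pair1[OF G_meas, of s] by simp
    have "(\<integral>\<^sup>+x. G x s / ennreal \<bar>b k\<bar> \<partial>PiM J (\<lambda>_. lborel))
        = (\<integral>\<^sup>+x. G x s / ennreal \<bar>b k\<bar> \<partial>distr (PiM J (\<lambda>_. lborel)) (PiM J (\<lambda>_. lborel)) (\<lambda>x. \<lambda>i\<in>J. x i + s * b i))"
      using J by (simp add: distr_PiM_lborel_translation)
    also have "\<dots> = (\<integral>\<^sup>+x. G (\<lambda>i\<in>J. x i + s * b i) s / ennreal \<bar>b k\<bar> \<partial>PiM J (\<lambda>_. lborel))"
      by (subst nn_integral_distr) auto
    also have "\<dots> = (\<integral>\<^sup>+x. F (x(k := (- B x - s) / b k)) / ennreal \<bar>b k\<bar> \<partial>PiM J (\<lambda>_. lborel))"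
    proof (rule nn_integral_cong)
      fix x :: "'i \<Rightarrow> real" assume "x \<in> space (PiM J (\<lambda>_. lborel))"
      then have "x \<in> extensional J" by (simp add: space_PiM PiE_iff)
      then have "(\<lambda>i\<in>J. (\<lambda>i\<in>J. x i + s * b i) i - s * b i) = x"
        by (auto simp: fun_eq_iff extensional_def)
      \<comment> \<open>This is where the squared norm \<open>2\<close> of \<open>b\<close> enters:
        the resulting point has scalar product \<open>- s\<close> with \<open>b\<close>.\<close>
      moreover have "(s - (B x + s * (2 - (b k)\<^sup>2))) / b k - s * b k = (- B x - s) / b k"
        using k by (simp add: field_simps power2_eq_square)
      ultimately show "G (\<lambda>i\<in>J. x i + s * b i) s / ennreal \<bar>b k\<bar> = F (x(k := (- B x - s) / b k)) / ennreal \<bar>b k\<bar>"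
        by (simp only: G_def B_shift)
    qed
    finally show "(\<integral>\<^sup>+x. G x s / ennreal \<bar>b k\<bar> \<partial>PiM J (\<lambda>_. lborel))
        = (\<integral>\<^sup>+x. F (x(k := (- B x - s) / b k)) / ennreal \<bar>b k\<bar> \<partial>PiM J (\<lambda>_. lborel))" .
  qed
  also have "\<dots> = (\<integral>\<^sup>+x. \<integral>\<^sup>+s. F (x(k := (- B x - s) / b k)) / ennreal \<bar>b k\<bar> \<partial>lborel \<partial>PiM J (\<lambda>_. lborel))"
    by (rule P.Fubini') simp
  \<comment> \<open>The substitution \<open>s = - B x - b k * y\<close> removes the sign, and its
    Jacobian factor is again \<open>\<bar>b k\<bar>\<close>, cancelling the division.\<close>
  also have "\<dots> = (\<integral>\<^sup>+x. \<integral>\<^sup>+y. F (x(k := y)) \<partial>lborel \<partial>PiM J (\<lambda>_. lborel))"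
  proof (rule nn_integral_cong)
    fix x :: "'i \<Rightarrow> real" assume [measurable]: "x \<in> space (PiM J (\<lambda>_. lborel))"
    have "(- B x - (- B x + - b k * y)) / b k = y" for y
      using k by simp
    then show "(\<integral>\<^sup>+s. F (x(k := (- B x - s) / b k)) / ennreal \<bar>b k\<bar> \<partial>lborel) = (\<integral>\<^sup>+y. F (x(k := y)) \<partial>lborel)"
      using k by (subst nn_integral_real_affine[where c = "- b k" and t = "- B x"])
        (simp_all add: nn_integral_cmult[symmetric] cancel)
  qed
  also have "\<dots> = (\<integral>\<^sup>+x. F x \<partial>PiM I (\<lambda>_. lborel))"
    unfolding I using J F by (subst product_nn_integral_insert) (auto simp: I)
  finally show ?thesis .
qed

section \<open>Reflections and the centred normal product measure\<close>

text \<open>With \<open>s\<close> the scalar product of \<open>b\<close> and \<open>x\<close>,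
  expanding the squares adds \<open>- 2 * s^2\<close> from the cross terms and
  \<open>2 * s^2\<close> from the squared norm of \<open>b\<close>.\<close>

lemma sum_power2_reflection:
  fixes b x :: "'i \<Rightarrow> real"
  assumes "(\<Sum>i\<in>I. (b i)\<^sup>2) = 2"
  shows "(\<Sum>i\<in>I. (x i - b i * (\<Sum>j\<in>I. b j * x j))\<^sup>2) = (\<Sum>i\<in>I. (x i)\<^sup>2)"
proof -
  define s where "s = (\<Sum>j\<in>I. b j * x j)"
  have "(\<Sum>i\<in>I. (x i - b i * s)\<^sup>2) = (\<Sum>i\<in>I. (x i)\<^sup>2 - 2 * s * (b i * x i) + s\<^sup>2 * (b i)\<^sup>2)"
    by (intro sum.cong) (auto simp: power2_eq_square algebra_simps)
  also have "\<dots> = (\<Sum>i\<in>I. (x i)\<^sup>2) - 2 * s * s + s\<^sup>2 * 2"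
    using assms by (simp add: sum.distrib sum_subtractf sum_distrib_left[symmetric] s_def)
  finally show ?thesis
    by (simp add: s_def power2_eq_square)
qed

text \<open>Exhibits the joint density as a function of the norm of \<open>x\<close> alone. For
  infinite \<open>I\<close> both sides are \<open>1\<close> by the conventions for
  \<open>prod\<close>, \<open>sum\<close> and \<open>card\<close>.\<close>

lemma prod_normal_density_zero_mean:
  "(\<Prod>i\<in>I. normal_density 0 \<sigma> (x i))
    = (1 / sqrt (2 * pi * \<sigma>\<^sup>2)) ^ card I * exp (- (\<Sum>i\<in>I. (x i)\<^sup>2) / (2 * \<sigma>\<^sup>2))"
proof (cases "finite I")
  case True
  have "exp (- (\<Sum>i\<in>I. (x i)\<^sup>2) / (2 * \<sigma>\<^sup>2)) = (\<Prod>i\<in>I. exp (- (x i)\<^sup>2 / (2 * \<sigma>\<^sup>2)))"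
    using True by (simp add: exp_sum[symmetric] sum_divide_distrib sum_negf)
  then show ?thesis
    unfolding normal_density_def prod.distrib prod_constant by simp
qed simp

lemma PiM_normal_reflection:
  fixes b :: "'i \<Rightarrow> real" and \<sigma> :: real
  defines "D \<equiv> density lborel (normal_density 0 \<sigma>)"
  assumes "finite I" and b2: "(\<Sum>i\<in>I. (b i)\<^sup>2) = 2" and "\<sigma> > 0"
  shows "distr (PiM I (\<lambda>_. D)) (PiM I (\<lambda>_. borel)) (\<lambda>x. \<lambda>i\<in>I. x i - b i * (\<Sum>j\<in>I. b j * x j))
       = PiM I (\<lambda>_. D)"
proof -
  let ?L = "PiM I (\<lambda>_. lborel :: real measure)"
  define H where "H x = (\<lambda>i\<in>I. x i - b i * (\<Sum>j\<in>I. b j * x j))" for x :: "'i \<Rightarrow> real"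
  define g where "g x = (\<Prod>i\<in>I. ennreal (normal_density 0 \<sigma> (x i)))" for x :: "'i \<Rightarrow> real"
  have D_eq: "PiM I (\<lambda>_. D) = density ?L g"
    unfolding D_def g_def using \<open>finite I\<close> prob_space_normal_density[OF \<open>\<sigma> > 0\<close>, of 0]
    by (intro PiM_density)
      (auto simp: sigma_finite_lborel prob_space_imp_sigma_finite)
  have [measurable]: "g \<in> borel_measurable ?L"
    unfolding g_def by measurable
  have [measurable]: "H \<in> ?L \<rightarrow>\<^sub>M ?L"
    unfolding H_def by measurable
  have g_H: "g (H x) = g x" for x
  proof -
    have "(\<Sum>i\<in>I. (H x i)\<^sup>2) = (\<Sum>i\<in>I. (x i)\<^sup>2)"
      using sum_power2_reflection[OF b2] by (simp add: H_def)
    then show ?thesis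
      by (simp add: g_def prod_ennreal prod_normal_density_zero_mean)
  qed
  have sets_eq: "sets (PiM I (\<lambda>_. borel)) = sets ?L"
    by (intro sets_PiM_cong) auto
  show ?thesis
    unfolding H_def[symmetric]
  proof (rule measure_eqI)
    show "sets (distr (PiM I (\<lambda>_. D)) (PiM I (\<lambda>_. borel)) H) = sets (PiM I (\<lambda>_. D))"
      using sets_eq by (simp add: D_eq)
    fix A assume "A \<in> sets (distr (PiM I (\<lambda>_. D)) (PiM I (\<lambda>_. borel)) H)"
    then have [measurable]: "A \<in> sets ?L"
      using sets_eq by simp
    have "emeasure (distr (density ?L g) (PiM I (\<lambda>_. borel)) H) A
        = emeasure (distr (density ?L g) ?L H) A"
      by (intro arg_cong2[where f = emeasure] distr_cong sets_eq refl)
    also have "\<dots> = (\<integral>\<^sup>+x. indicator A (H x) \<partial>density ?L g)"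
      by (subst nn_integral_indicator[symmetric], simp, subst nn_integral_distr) auto
    \<comment> \<open>Writing \<open>g (H x)\<close> for \<open>g x\<close> makes the whole
      integrand a function of \<open>H x\<close>, ready for the invariance of Lebesgue
      measure.\<close>
    also have "\<dots> = (\<integral>\<^sup>+x. g (H x) * indicator A (H x) \<partial>?L)"
      by (subst nn_integral_density) (auto simp: g_H)
    also have "\<dots> = (\<integral>\<^sup>+x. g x * indicator A x \<partial>?L)"
      using nn_integral_PiM_lborel_reflection[OF \<open>finite I\<close> b2, of "\<lambda>x. g x * indicator A x"]
      by (simp add: H_def)
    also have "\<dots> = emeasure (density ?L g) A"
      by (intro emeasure_density[symmetric]) auto
    finally show "emeasure (distr (PiM I (\<lambda>_. D)) (PiM I (\<lambda>_. borel)) H) A = emeasure (PiM I (\<lambda>_. D)) A"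
      by (simp only: D_eq)
  qed
qed

section \<open>Families of i.i.d. normal variables\<close>

lemma (in prob_space) indep_vars_reindex:
  assumes "inj_on f I" "indep_vars M' X (f ` I)"
  shows "indep_vars (\<lambda>i. M' (f i)) (\<lambda>i. X (f i)) I"
proof -
  define F where "F i = sigma_sets (space M) {X i -` A \<inter> space M |A. A \<in> sets (M' i)}" for i
  have rv: "\<And>i. i \<in> I \<Longrightarrow> random_variable (M' (f i)) (X (f i))" and ind: "indep_sets F (f ` I)"
    using assms(2) unfolding indep_vars_def F_def by simp_all
  have "indep_sets (\<lambda>i. F (f i)) I"
  proof (rule indep_setsI)
    show "F (f i) \<subseteq> events" if "i \<in> I" for i
      using ind that by (auto simp: indep_sets_def)
    fix A J assume J: "J \<noteq> {}" "J \<subseteq> I" "finite J" "\<forall>j\<in>J. A j \<in> F (f j)"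
    have inj: "inj_on f J" using assms(1) J(2) by (rule inj_on_subset)
    have inv [simp]: "the_inv_into J f (f j) = j" if "j \<in> J" for j
      using inj that by (rule the_inv_into_f_f)
    have "prob (\<Inter>k\<in>f ` J. A (the_inv_into J f k)) = (\<Prod>k\<in>f ` J. prob (A (the_inv_into J f k)))"
      using J by (intro indep_setsD[OF ind]) auto
    then show "prob (\<Inter>j\<in>J. A j) = (\<Prod>j\<in>J. prob (A j))"
      using inj by (simp add: prod.reindex cong: INF_cong prod.cong)
  qed
  with rv show ?thesis by (simp add: indep_vars_def F_def)
qed

lemma (in prob_space) iid_normal_reindex:
  assumes "inj_on f J" "f ` J \<subseteq> I" "iid_normal M X I \<mu> \<sigma>"
  shows "iid_normal M (\<lambda>j. X (f j)) J \<mu> \<sigma>"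
  using assms indep_vars_reindex[of f J "\<lambda>_. borel" X] indep_vars_subset[of "\<lambda>_. borel" X I "f ` J"]
  by (auto simp: iid_normal_def)

text \<open>Being independent with common law \<open>D\<close> means having joint law
  \<open>PiM I (\<lambda>_. D)\<close>, and this measure is invariant under the reflection.\<close>

lemma (in prob_space) iid_normal_reflection:
  fixes X :: "nat \<Rightarrow> 'a \<Rightarrow> real" and b :: "nat \<Rightarrow> real"
  assumes "finite I" and b2: "(\<Sum>i\<in>I. (b i)\<^sup>2) = 2" and "\<sigma> > 0"
    and X: "iid_normal M X I 0 \<sigma>"
  shows "iid_normal M (\<lambda>i \<omega>. X i \<omega> - b i * (\<Sum>j\<in>I. b j * X j \<omega>)) I 0 \<sigma>"
proof -
  define D where "D = density lborel (\<lambda>x. ennreal (normal_density 0 \<sigma> x))"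
  define W where "W i \<omega> = X i \<omega> - b i * (\<Sum>j\<in>I. b j * X j \<omega>)" for i \<omega>
  define H where "H x = (\<lambda>i\<in>I. x i - b i * (\<Sum>j\<in>I. b j * x j))" for x :: "nat \<Rightarrow> real"
  have "I \<noteq> {}" using b2 by auto
  have D: "prob_space D"
    unfolding D_def by (rule prob_space_normal_density[OF \<open>\<sigma> > 0\<close>])
  have rv [measurable]: "random_variable borel (X i)" if "i \<in> I" for i
    using X that by (auto simp: iid_normal_def indep_vars_def)
  have W_rv [measurable]: "random_variable borel (W i)" if "i \<in> I" for i
    unfolding W_def using that by measurable
  have [measurable]: "H \<in> PiM I (\<lambda>_. borel) \<rightarrow>\<^sub>M PiM I (\<lambda>_. borel)"
    unfolding H_def by measurable
  have X_distr: "distr M borel (X i) = D" if "i \<in> I" for i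
  proof -
    have "distr M borel (X i) = distr M lborel (X i)"
      by (intro distr_cong) auto
    then show ?thesis
      using X that by (auto simp: iid_normal_def D_def distributed_distr_eq_density)
  qed
  have "distr M (PiM I (\<lambda>_. borel)) (\<lambda>\<omega>. \<lambda>i\<in>I. X i \<omega>) = PiM I (\<lambda>i. distr M borel (X i))"
    using X rv \<open>I \<noteq> {}\<close> by (subst indep_vars_iff_distr_eq_PiM'[symmetric]) (auto simp: iid_normal_def)
  also have "\<dots> = PiM I (\<lambda>_. D)"
    by (intro PiM_cong) (auto simp: X_distr)
  finally have X_joint: "distr M (PiM I (\<lambda>_. borel)) (\<lambda>\<omega>. \<lambda>i\<in>I. X i \<omega>) = PiM I (\<lambda>_. D)" .
  have "(\<lambda>\<omega>. \<lambda>i\<in>I. W i \<omega>) = H \<circ> (\<lambda>\<omega>. \<lambda>i\<in>I. X i \<omega>)"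
    by (auto simp: fun_eq_iff H_def W_def)
  then have "distr M (PiM I (\<lambda>_. borel)) (\<lambda>\<omega>. \<lambda>i\<in>I. W i \<omega>)
      = distr (distr M (PiM I (\<lambda>_. borel)) (\<lambda>\<omega>. \<lambda>i\<in>I. X i \<omega>)) (PiM I (\<lambda>_. borel)) H"
    by (subst distr_distr) auto
  also have "\<dots> = PiM I (\<lambda>_. D)"
    using PiM_normal_reflection[OF \<open>finite I\<close> b2 \<open>\<sigma> > 0\<close>]
    by (simp add: X_joint D_def H_def[abs_def])
  finally have W_joint: "distr M (PiM I (\<lambda>_. borel)) (\<lambda>\<omega>. \<lambda>i\<in>I. W i \<omega>) = PiM I (\<lambda>_. D)" .
  \<comment> \<open>The criterion for independence compares the joint law with the product of the
    marginals, so these are first read off from \<open>W_joint\<close> by projection.\<close>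
  have W_distr: "distr M borel (W i) = D" if "i \<in> I" for i
  proof -
    have "distr M borel (W i) = distr M borel ((\<lambda>x. x i) \<circ> (\<lambda>\<omega>. \<lambda>i\<in>I. W i \<omega>))"
      using that by (intro distr_cong) auto
    also have "\<dots> = distr (distr M (PiM I (\<lambda>_. borel)) (\<lambda>\<omega>. \<lambda>i\<in>I. W i \<omega>)) borel (\<lambda>x. x i)"
      using that by (subst distr_distr) auto
    also have "\<dots> = distr (PiM I (\<lambda>_. D)) D (\<lambda>x. x i)"
      unfolding W_joint by (intro distr_cong) (auto simp: D_def)
    also have "\<dots> = D"
      using D that by (rule distr_PiM_component)
    finally show ?thesis .
  qed
  have "distr M (PiM I (\<lambda>_. borel)) (\<lambda>\<omega>. \<lambda>i\<in>I. W i \<omega>) = PiM I (\<lambda>i. distr M borel (W i))"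
    unfolding W_joint by (intro PiM_cong) (auto simp: W_distr)
  then have "indep_vars (\<lambda>_. borel) W I"
    using \<open>I \<noteq> {}\<close> by (subst indep_vars_iff_distr_eq_PiM') auto
  moreover have "distributed M lborel (W i) (normal_density 0 \<sigma>)" if "i \<in> I" for i
  proof -
    have "distr M lborel (W i) = distr M borel (W i)"
      by (intro distr_cong) auto
    then show ?thesis
      using that W_distr by (auto simp: distributed_def D_def)
  qed
  ultimately show ?thesis
    by (simp add: iid_normal_def W_def[abs_def])
qed

lemma (in prob_space) iid_normal_center:
  assumes "\<sigma> > 0" "iid_normal M X I \<mu> \<sigma>"
  shows "iid_normal M (\<lambda>i \<omega>. X i \<omega> - \<mu>) I 0 \<sigma>"
  unfolding iid_normal_def
proof (intro conjI ballI)
  show "indep_vars (\<lambda>_. borel) (\<lambda>i \<omega>. X i \<omega> - \<mu>) I"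
    using assms by (intro indep_vars_compose2[where X = X and Y = "\<lambda>_ x. x - \<mu>"]) (auto simp: iid_normal_def)
  show "distributed M lborel (\<lambda>\<omega>. X i \<omega> - \<mu>) (normal_density 0 \<sigma>)" if "i \<in> I" for i
    using assms that normal_density_affine[of "X i" \<mu> \<sigma> 1 "- \<mu>"] by (simp add: iid_normal_def)
qed

text \<open>The combination is normal with variance \<open>\<tau>^2 > 0\<close>, whereas a variable
  that is zero on all of \<open>space M\<close> has variance \<open>0\<close>. Nonzero coefficients
  keep every summand a nondegenerate normal variable.\<close>

lemma (in prob_space) iid_normal_linear_combination_nonzero:
  fixes X :: "nat \<Rightarrow> 'a \<Rightarrow> real"
  assumes "finite I" "I \<noteq> {}" "\<sigma> > 0" and X: "iid_normal M X I 0 \<sigma>" and a: "\<And>i. i \<in> I \<Longrightarrow> a i \<noteq> 0"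
  shows "\<exists>\<omega>\<in>space M. (\<Sum>i\<in>I. a i * X i \<omega>) \<noteq> 0"
proof (rule ccontr)
  assume "\<not> ?thesis"
  then have zero: "\<And>\<omega>. \<omega> \<in> space M \<Longrightarrow> (\<Sum>i\<in>I. a i * X i \<omega>) = 0" by blast
  define \<tau> where "\<tau> = sqrt (\<Sum>i\<in>I. (\<bar>a i\<bar> * \<sigma>)\<^sup>2)"
  have "\<tau> > 0"
    unfolding \<tau>_def using assms by (intro real_sqrt_gt_zero sum_pos) auto
  have "distributed M lborel (\<lambda>\<omega>. \<Sum>i\<in>I. a i * X i \<omega>) (normal_density (\<Sum>i\<in>I. 0) \<tau>)"
    unfolding \<tau>_def
  proof (rule sum_indep_normal)
    show "indep_vars (\<lambda>_. borel) (\<lambda>i \<omega>. a i * X i \<omega>) I"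
      using X by (intro indep_vars_compose2[where X = X and Y = "\<lambda>i x. a i * x"]) (auto simp: iid_normal_def)
    show "distributed M lborel (\<lambda>\<omega>. a i * X i \<omega>) (normal_density 0 (\<bar>a i\<bar> * \<sigma>))" if "i \<in> I" for i
      using X that a \<open>\<sigma> > 0\<close> normal_density_affine[of "X i" 0 \<sigma> "a i" 0] by (auto simp: iid_normal_def)
  qed (use assms in auto)
  then have "variance (\<lambda>\<omega>. \<Sum>i\<in>I. a i * X i \<omega>) = \<tau>\<^sup>2"
    using \<open>\<tau> > 0\<close> normal_distributed_variance by blast
  moreover have "variance (\<lambda>\<omega>. \<Sum>i\<in>I. a i * X i \<omega>) = 0"
    using zero by (simp cong: Bochner_Integration.integral_cong)
  ultimately show False using \<open>\<tau> > 0\<close> by simp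
qed

section \<open>Algebra of the residuals and the quadratic for \<open>c\<close>\<close>

lemma sum_residual: "n \<ge> 1 \<Longrightarrow> (\<Sum>j=1..n. residual n Y j \<omega>) = 0"
  by (simp add: residual_def sample_mean_def sum_subtractf)

text \<open>Subtracting a common constant from the sample leaves the residuals unchanged, so centred
  variables can be used.\<close>

lemma residual_center:
  assumes "n \<ge> 1"
  shows "residual n Y j \<omega> = (Y j \<omega> - \<mu>) - (\<Sum>i=1..n. Y i \<omega> - \<mu>) / real n"
  using assms by (simp add: residual_def sample_mean_def sum_subtractf field_simps)

text \<open>The residuals other than the first sum to \<open>- R 1\<close>, which evaluates the
  cross term as \<open>- 2 * c * (R 1)^2\<close>. The \<open>- 1\<close> compensates for
  \<open>(R 1)^2\<close>, which occurs only in the sum on the right.\<close>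

lemma sum_shifted_residual_power2:
  assumes "n \<ge> 1"
  shows "(\<Sum>j=1..n - 1. (shifted_residual n Y c j \<omega>)\<^sup>2)
      = (\<Sum>j=1..n. (residual n Y j \<omega>)\<^sup>2) + (real (n - 1) * c\<^sup>2 - 2 * c - 1) * (residual n Y 1 \<omega>)\<^sup>2"
proof -
  define R where "R j = residual n Y j \<omega>" for j
  have split: "(\<Sum>j=1..n. f j) = f 1 + (\<Sum>j=1..n - 1. f (j + 1))" for f :: "nat \<Rightarrow> real"
    using assms sum.shift_bounds_cl_nat_ivl[of f 1 1 "n - 1"] sum.atLeast_Suc_atMost[of 1 n f] by simp
  have sum_R: "(\<Sum>j=1..n - 1. R (j + 1)) = - R 1"
    using sum_residual[OF assms, of Y \<omega>] unfolding split[of "\<lambda>j. residual n Y j \<omega>"] by (simp add: R_def)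
  have "(\<Sum>j=1..n - 1. (R (j + 1) + c * R 1)\<^sup>2)
      = (\<Sum>j=1..n - 1. (R (j + 1))\<^sup>2 + 2 * c * R 1 * R (j + 1) + c\<^sup>2 * (R 1)\<^sup>2)"
    by (intro sum.cong) (auto simp: power2_eq_square algebra_simps)
  also have "\<dots> = (\<Sum>j=1..n - 1. (R (j + 1))\<^sup>2) + 2 * c * R 1 * (- R 1) + real (n - 1) * (c\<^sup>2 * (R 1)\<^sup>2)"
    unfolding sum_R[symmetric] by (simp add: sum.distrib sum_distrib_left)
  also have "\<dots> = (\<Sum>j=1..n. (R j)\<^sup>2) + (real (n - 1) * c\<^sup>2 - 2 * c - 1) * (R 1)\<^sup>2"
    unfolding split[of "\<lambda>j. (R j)\<^sup>2"] by (simp add: power2_eq_square algebra_simps)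
  finally show ?thesis
    by (simp add: R_def shifted_residual_def)
qed

text \<open>With \<open>r = sqrt (real n)\<close>, the leading coefficient is
  \<open>(r - 1) * (r + 1)\<close>, and the quadratic splits into two linear factors. Since
  \<open>n \<ge> 2\<close>, both have nonzero slope.\<close>

lemma shift_quadratic_roots:
  assumes "n \<ge> 2"
  shows "real (n - 1) * c\<^sup>2 - 2 * c - 1 = 0
     \<longleftrightarrow> c = 1 / (sqrt (real n) - 1) \<or> c = - 1 / (sqrt (real n) + 1)"
proof -
  define r where "r = sqrt (real n)"
  have r: "r > 1" "real (n - 1) = r\<^sup>2 - 1"
    using assms by (auto simp: r_def of_nat_diff)
  have "real (n - 1) * c\<^sup>2 - 2 * c - 1 = ((r - 1) * c - 1) * ((r + 1) * c + 1)"
    unfolding r by (simp add: power2_eq_square algebra_simps)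
  moreover have "(r - 1) * c - 1 = 0 \<longleftrightarrow> c = 1 / (r - 1)" "(r + 1) * c + 1 = 0 \<longleftrightarrow> c = - 1 / (r + 1)"
    using r(1) by (auto simp: field_simps)
  ultimately show ?thesis by (simp add: r_def)
qed

section \<open>Distribution of the shifted residuals, nondegeneracy of the first residual\<close>

lemma (in prob_space) iid_normal_shifted_residual:
  assumes "n \<ge> 2" "\<sigma> > 0" and Y: "iid_normal M Y {1..n} \<mu> \<sigma>"
    and c: "real (n - 1) * c\<^sup>2 - 2 * c - 1 = 0"
  shows "iid_normal M (shifted_residual n Y c) {1..n - 1} 0 \<sigma>"
proof -
  define X where "X i \<omega> = Y i \<omega> - \<mu>" for i \<omega>
  \<comment> \<open>\<open>\<beta>\<close> and \<open>b\<close> are obtained by matching the coefficients of \<open>W\<^sub>j\<close> with those of the reflection.\<close>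
  define \<beta> where "\<beta> = sqrt ((1 + c) / real n)"
  define b where "b = (\<lambda>i::nat. \<beta>)(1 := \<beta> - c / \<beta>)"
  have n: "real (n - 1) = real n - 1" "real n > 0" using assms(1) by auto
  have "real (n - 1) * c\<^sup>2 \<ge> 0" by simp
  \<comment> \<open>The quadratic says \<open>1 + 2 * c = real (n - 1) * c^2\<close>, which is
    nonnegative, hence \<open>c \<ge> - 1/2\<close>.\<close>
  then have "1 + c > 0" using c by linarith
  then have \<beta>: "\<beta> > 0" "\<beta>\<^sup>2 = (1 + c) / real n" using n by (auto simp: \<beta>_def)
  have split: "{1..n} = insert 1 {2..n}" using assms(1) by auto
  have "(\<Sum>i\<in>{1..n}. (b i)\<^sup>2) = (\<beta> - c / \<beta>)\<^sup>2 + (real n - 1) * \<beta>\<^sup>2"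
    unfolding split using assms(1) by (simp add: b_def)
  also have "\<dots> = real n * \<beta>\<^sup>2 - 2 * c + c\<^sup>2 / \<beta>\<^sup>2"
    using \<beta>(1) by (simp add: power2_eq_square field_simps)
  also have "\<dots> = (1 - c) + real n * c\<^sup>2 / (1 + c)"
    using n by (simp add: \<beta>(2) mult.commute)
  \<comment> \<open>The quadratic for \<open>c\<close> again: adding \<open>c^2\<close> to
    \<open>real (n - 1) * c^2 = 1 + 2 * c\<close> completes the square.\<close>
  also have "real n * c\<^sup>2 = (1 + c) * (1 + c)"
    using n c by (simp add: power2_eq_square algebra_simps)
  also have "(1 - c) + (1 + c) * (1 + c) / (1 + c) = 2"
    using \<open>1 + c > 0\<close> by simp
  finally have b2: "(\<Sum>i\<in>{1..n}. (b i)\<^sup>2) = 2" .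
  \<comment> \<open>In centred variables the left side is \<open>X (j + 1) + c * X 1\<close> minus
    \<open>1 + c\<close> times the mean of the \<open>X i\<close>. Since
    \<open>j + 1 \<ge> 2\<close>, the outer coefficient is \<open>\<beta>\<close>; then
    \<open>\<beta> * (b 1 - \<beta>) = - c\<close> and \<open>\<beta>^2 = (1 + c) / real n\<close>
    give the match.\<close>
  have W: "shifted_residual n Y c j \<omega> = X (j + 1) \<omega> - b (j + 1) * (\<Sum>i\<in>{1..n}. b i * X i \<omega>)"
    if "j \<in> {1..n - 1}" for j \<omega>
  proof -
    have "(\<Sum>i\<in>{1..n}. b i * X i \<omega>) = \<beta> * (\<Sum>i\<in>{1..n}. X i \<omega>) - c / \<beta> * X 1 \<omega>"
      unfolding split by (simp add: b_def sum_distrib_left algebra_simps)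
    moreover have "b (j + 1) = \<beta>"
      using that by (simp add: b_def)
    ultimately have "b (j + 1) * (\<Sum>i\<in>{1..n}. b i * X i \<omega>) = \<beta>\<^sup>2 * (\<Sum>i\<in>{1..n}. X i \<omega>) - c * X 1 \<omega>"
      using \<beta>(1) by (simp add: power2_eq_square right_diff_distrib)
    also have "\<dots> = (1 + c) * ((\<Sum>i\<in>{1..n}. X i \<omega>) / real n) - c * X 1 \<omega>"
      by (simp add: \<beta>(2))
    finally show ?thesis
      using assms(1) by (simp add: shifted_residual_def residual_center[of n Y _ \<omega> \<mu>] X_def algebra_simps add_divide_distrib)
  qed
  have "iid_normal M (\<lambda>i \<omega>. X i \<omega> - b i * (\<Sum>j\<in>{1..n}. b j * X j \<omega>)) {1..n} 0 \<sigma>"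
    using iid_normal_center[OF \<open>\<sigma> > 0\<close> Y] b2 \<open>\<sigma> > 0\<close>
    by (intro iid_normal_reflection) (auto simp: X_def[abs_def])
  \<comment> \<open>Coordinate \<open>1\<close> of the reflected sample is dropped, and the others
    are renumbered by \<open>i = j + 1\<close>.\<close>
  then have "iid_normal M (\<lambda>j \<omega>. X (j + 1) \<omega> - b (j + 1) * (\<Sum>i\<in>{1..n}. b i * X i \<omega>)) {1..n - 1} 0 \<sigma>"
    by (rule iid_normal_reindex[rotated 2]) (auto simp: inj_on_def)
  moreover have "indep_vars (\<lambda>_. borel) (shifted_residual n Y c) {1..n - 1}
      \<longleftrightarrow> indep_vars (\<lambda>_. borel) (\<lambda>j \<omega>. X (j + 1) \<omega> - b (j + 1) * (\<Sum>i\<in>{1..n}. b i * X i \<omega>)) {1..n - 1}"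
    by (intro indep_vars_cong refl) (simp add: fun_eq_iff W)
  ultimately show ?thesis
    unfolding iid_normal_def by (simp add: ext[OF W])
qed

text \<open>Supplies a point at which equality of the sums of squares can be divided by the squared
  first residual.\<close>

lemma (in prob_space) iid_normal_residual_nonzero:
  assumes "n \<ge> 2" "\<sigma> > 0" and Y: "iid_normal M Y {1..n} \<mu> \<sigma>"
  shows "\<exists>\<omega>\<in>space M. residual n Y 1 \<omega> \<noteq> 0"
proof -
  define X where "X i \<omega> = Y i \<omega> - \<mu>" for i \<omega>
  \<comment> \<open>The coefficients of the first residual in the centred sample;
    \<open>n \<ge> 2\<close> makes \<open>1 - 1 / real n\<close> nonzero.\<close>
  define a where "a = (\<lambda>i::nat. - 1 / real n)(1 := 1 - 1 / real n)"
  have split: "{1..n} = insert 1 {2..n}" using assms(1) by auto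
  have "residual n Y 1 \<omega> = (\<Sum>i\<in>{1..n}. a i * X i \<omega>)" for \<omega>
  proof -
    have "(\<Sum>i\<in>{2..n}. a i * X i \<omega>) = - 1 / real n * (\<Sum>i\<in>{2..n}. X i \<omega>)"
      unfolding sum_distrib_left by (intro sum.cong) (auto simp: a_def)
    moreover have "residual n Y 1 \<omega> = X 1 \<omega> - (\<Sum>i\<in>{1..n}. X i \<omega>) / real n"
      unfolding X_def using assms(1) by (intro residual_center) auto
    ultimately show ?thesis
      unfolding split by (simp add: a_def algebra_simps add_divide_distrib)
  qed
  moreover have "\<exists>\<omega>\<in>space M. (\<Sum>i\<in>{1..n}. a i * X i \<omega>) \<noteq> 0"
  proof (rule iid_normal_linear_combination_nonzero[OF _ _ \<open>\<sigma> > 0\<close>])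
    show "iid_normal M X {1..n} 0 \<sigma>"
      using iid_normal_center[OF \<open>\<sigma> > 0\<close> Y] by (simp add: X_def[abs_def])
  qed (use assms(1) in \<open>auto simp: a_def\<close>)
  ultimately show ?thesis by simp
qed

section \<open>The two admissible values of \<open>c\<close>\<close>

theorem theorem6:
  fixes M :: "'a measure" and Y :: "nat \<Rightarrow> 'a \<Rightarrow> real"
    and n :: nat and \<mu> \<sigma> :: real
  assumes "prob_space M"
    and "n \<ge> 2"
    and "\<sigma> > 0"
    and "iid_normal M Y {1..n} \<mu> \<sigma>"
  shows "{c :: real.
            iid_normal M (shifted_residual n Y c) {1..n - 1} 0 \<sigma> \<and>
            (\<forall>\<omega>\<in>space M. (\<Sum>j = 1..n - 1. (shifted_residual n Y c j \<omega>)\<^sup>2)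
                         = (\<Sum>j = 1..n. (residual n Y j \<omega>)\<^sup>2))}
         = {1 / (sqrt (real n) - 1), - 1 / (sqrt (real n) + 1)}
       \<and> 1 / (sqrt (real n) - 1) \<noteq> - 1 / (sqrt (real n) + 1)"
proof -
  interpret prob_space M by fact
  obtain \<omega>0 where "\<omega>0 \<in> space M" "residual n Y 1 \<omega>0 \<noteq> 0"
    using iid_normal_residual_nonzero assms by blast
  \<comment> \<open>Evaluation at \<open>\<omega>0\<close> forces the quadratic to vanish;
    conversely, a root makes the correction term zero at every point.\<close>
  then have squares: "(\<forall>\<omega>\<in>space M. (\<Sum>j = 1..n - 1. (shifted_residual n Y c j \<omega>)\<^sup>2)
      = (\<Sum>j = 1..n. (residual n Y j \<omega>)\<^sup>2)) \<longleftrightarrow> real (n - 1) * c\<^sup>2 - 2 * c - 1 = 0" for c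
    using assms(2) by (subst sum_shifted_residual_power2) auto
  have "iid_normal M (shifted_residual n Y c) {1..n - 1} 0 \<sigma>
      \<and> (\<forall>\<omega>\<in>space M. (\<Sum>j = 1..n - 1. (shifted_residual n Y c j \<omega>)\<^sup>2)
           = (\<Sum>j = 1..n. (residual n Y j \<omega>)\<^sup>2))
    \<longleftrightarrow> c = 1 / (sqrt (real n) - 1) \<or> c = - 1 / (sqrt (real n) + 1)" for c
    \<comment> \<open>Every root also satisfies the distributional condition, so the conjunction
      reduces to the quadratic.\<close>
    unfolding squares shift_quadratic_roots[OF assms(2), symmetric]
    using iid_normal_shifted_residual[OF assms(2-4)] by blast
  moreover have "- 1 / (sqrt (real n) + 1) < 0" "0 < 1 / (sqrt (real n) - 1)"
    using assms(2) by (auto intro!: divide_neg_pos add_pos_nonneg)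
  then have "1 / (sqrt (real n) - 1) \<noteq> - 1 / (sqrt (real n) + 1)" by linarith
  ultimately show ?thesis by (intro conjI set_eqI) blast+
qed

end
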